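(* For every $m\in[0,1]$, $V(m)=S(m)$, where $$S(m)=m\log\Big(\frac{m}{\gamma}\Big)+(1-m)\log\Big(\frac{1-m}{1-\gamma}\Big)$$ (with the convention $0\log 0=0$) and $$V(m)=\inf_{T>0}\ \inf_{a}\ I_T(a|\gamma),$$ the second infimum being over all $a\in C^1([0,T])$ with values in $[0,1]$ and $a(T)=m$.
   Context: Let $0<\alpha,\beta<1$ and $\gamma=(\alpha+\beta)/2$. For $T>0$ let $\mathcal{D}^T_{[0,1]}$ be the set of right-continuous functions with left limits $a:[0,T]\to[0,1]$. For $G\in C^1([0,T])$ (real-valued) and $a\in\mathcal{D}^T_{[0,1]}$ set $$J_{T,G}(a)=a_TG_T-a_0G_0-\int_0^Ta_s\,\partial_sG_s\,ds-\int_0^TA_G(a)(s)\,ds,$$ $$A_G(a)(s)=2\gamma(1-a_s)(e^{G_s}-1)+2(1-\gamma)a_s(e^{-G_s}-1).$$ Let $I_T(a)=\sup_{G\in C^1([0,T])}J_{T,G}(a)\in\mathbb{R}\cup\{+\infty\}$, and for $m_0\in[0,1]$ let $I_T(a|m_0)=I_T(a)$ if $a(0)=m_0$ and $I_T(a|m_0)=+\infty$ otherwise. *)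

theory Defs
  imports "HOL-Analysis.Analysis"
begin

(* A function on [0,T] is represented by a total function real => real whose values
   outside [0,T] are irrelevant; differentiability at 0 and T is one-sided. *)
definition C1 :: "real \<Rightarrow> (real \<Rightarrow> real) set" where
  "C1 T = {f. \<exists>f'. continuous_on {0..T} f' \<and>
                 (\<forall>s\<in>{0..T}. (f has_real_derivative f' s) (at s within {0..T}))}"

definition cadlag_paths :: "real \<Rightarrow> (real \<Rightarrow> real) set" where
  "cadlag_paths T = {a. a ` {0..T} \<subseteq> {0..1} \<and>
      (\<forall>t\<in>{0..<T}. (a \<longlongrightarrow> a t) (at_right t)) \<and>
      (\<forall>t\<in>{0<..T}. \<exists>l. (a \<longlongrightarrow> l) (at_left t))}"

definition drift :: "real \<Rightarrow> (real \<Rightarrow> real) \<Rightarrow> (real \<Rightarrow> real) \<Rightarrow> real \<Rightarrow> real" where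
  "drift \<gamma> G a s = 2 * \<gamma> * (1 - a s) * (exp (G s) - 1) + 2 * (1 - \<gamma>) * a s * (exp (- G s) - 1)"

definition J :: "real \<Rightarrow> real \<Rightarrow> (real \<Rightarrow> real) \<Rightarrow> (real \<Rightarrow> real) \<Rightarrow> real" where
  "J \<gamma> T G a = a T * G T - a 0 * G 0
     - integral {0..T} (\<lambda>s. a s * vector_derivative G (at s within {0..T}))
     - integral {0..T} (drift \<gamma> G a)"

(* The rate function on cadlag_paths T; V evaluates it only on C1_paths_to T m, which is
   contained in cadlag_paths T by C1_paths_to_subset_cadlag below. *)
definition rate :: "real \<Rightarrow> real \<Rightarrow> (real \<Rightarrow> real) \<Rightarrow> ereal" where
  "rate \<gamma> T a = (SUP G\<in>C1 T. ereal (J \<gamma> T G a))"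

definition rate_from :: "real \<Rightarrow> real \<Rightarrow> (real \<Rightarrow> real) \<Rightarrow> real \<Rightarrow> ereal" where
  "rate_from \<gamma> T a m0 = (if a 0 = m0 then rate \<gamma> T a else \<infinity>)"

definition C1_paths_to :: "real \<Rightarrow> real \<Rightarrow> (real \<Rightarrow> real) set" where
  "C1_paths_to T m = {a \<in> C1 T. a ` {0..T} \<subseteq> {0..1} \<and> a T = m}"

definition V :: "real \<Rightarrow> real \<Rightarrow> ereal" where
  "V \<gamma> m = (INF T\<in>{0<..}. INF a\<in>C1_paths_to T m. rate_from \<gamma> T a \<gamma>)"

(* The convention 0 log 0 = 0 needs no case distinction, as 0 * x = 0 for every real x. *)
definition S :: "real \<Rightarrow> real \<Rightarrow> real" where
  "S \<gamma> m = m * ln (m / \<gamma>) + (1 - m) * ln ((1 - m) / (1 - \<gamma>))"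

lemma C1_paths_to_subset_cadlag: "C1_paths_to T m \<subseteq> cadlag_paths T"
proof
  fix a assume a: "a \<in> C1_paths_to T m"
  then have cont: "continuous_on {0..T} a"
    unfolding C1_paths_to_def C1_def
    by (auto simp: continuous_on_eq_continuous_within intro: DERIV_continuous)
  have r: "(a \<longlongrightarrow> a t) (at_right t)" if "t \<in> {0..<T}" for t
  proof -
    have "(a \<longlongrightarrow> a t) (at t within {t..T})"
      using continuous_on_subset[OF cont, of "{t..T}"] that by (auto simp: continuous_on_def)
    then show ?thesis using that by (simp add: at_within_Icc_at_right)
  qed
  have l: "(a \<longlongrightarrow> a t) (at_left t)" if "t \<in> {0<..T}" for t
  proof -
    have "(a \<longlongrightarrow> a t) (at t within {0..t})"
      using continuous_on_subset[OF cont, of "{0..t}"] that by (auto simp: continuous_on_def)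
    then show ?thesis using that by (simp add: at_within_Icc_at_left)
  qed
  show "a \<in> cadlag_paths T"
    using a r l unfolding cadlag_paths_def C1_paths_to_def by blast
qed

lemma vector_derivative_C1:
  assumes "0 < T" "s \<in> {0..T}" "(G has_real_derivative D) (at s within {0..T})"
  shows "vector_derivative G (at s within {0..T}) = D"
  using assms by (intro vector_derivative_within_closed_interval)
    (auto simp: has_real_derivative_iff_has_vector_derivative)

end

theory Submission
  imports Defs "HOL-Real_Asymp.Real_Asymp"
begin

text \<open>
  Write \<open>H(a, p)\<close> for the Hamiltonian, so that \<open>J(a) = \<integral> a' G - H(a, G)\<close> for a \<open>C\<^sup>1\<close> path.
  The entropy solves \<open>H(a, S'(a)) = 0\<close>. Testing with (a regularisation of) \<open>G = S'(a)\<close>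
  bounds the cost of every path below by \<open>S(m) - S(\<gamma>)\<close>, where \<open>S(\<gamma>) = 0\<close>. Conversely,
  \<open>H(a, S'(a) + q)\<close> is the Hamiltonian of the time-reversed dynamics, whose drift is
  \<open>2(a - \<gamma>)\<close>, so a path with \<open>a' = 2(a - \<gamma>) + w\<close>, where \<open>w\<close> points away from \<open>\<gamma>\<close>,
  costs at most \<open>S(m)\<close> plus a multiple of \<open>\<integral> w\<^sup>2\<close>. For
  \<open>a(t) = \<gamma> + (m - \<gamma>) sinh(2t) / sinh(2T)\<close> this error vanishes as \<open>T\<close> tends to infinity.
\<close>

section \<open>The entropy, its regularisation and its derivative\<close>

definition reg_entropy :: "real \<Rightarrow> real \<Rightarrow> real \<Rightarrow> real" where
  "reg_entropy \<gamma> \<epsilon> x =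
     (x + \<epsilon>) * ln (x + \<epsilon>) + (1 - x + \<epsilon>) * ln (1 - x + \<epsilon>) + x * ln ((1 - \<gamma>) / \<gamma>)"

text \<open>The derivative of \<open>reg_entropy\<close>; at \<epsilon> = 0 it is S' on (0,1). A
  shift \<epsilon> > 0 keeps it smooth on all of [0,1], so that along a path touching 0 or 1 it is
  still a \<open>C1\<close> test function.\<close>

definition reg_force :: "real \<Rightarrow> real \<Rightarrow> real \<Rightarrow> real" where
  "reg_force \<gamma> \<epsilon> x = ln (x + \<epsilon>) - ln (1 - x + \<epsilon>) + ln ((1 - \<gamma>) / \<gamma>)"

lemma continuous_on_x_ln_x: "continuous_on {0..} (\<lambda>x::real. x * ln x)"
proof -
  have "((\<lambda>x::real. x * ln x) \<longlongrightarrow> 0) (at_right 0)"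
    by real_asymp
  then have "continuous (at x within {0..}) (\<lambda>x::real. x * ln x)" if "x \<ge> 0" for x
  proof (cases "x = 0")
    case True
    then show ?thesis
      using \<open>((\<lambda>x::real. x * ln x) \<longlongrightarrow> 0) (at_right 0)\<close>
      by (simp add: continuous_within at_within_Ici_at_right)
  next
    case False
    then have "isCont (\<lambda>x::real. x * ln x) x"
      by (intro continuous_intros) auto
    then show ?thesis
      using continuous_at_imp_continuous_at_within by blast
  qed
  then show ?thesis
    by (simp add: continuous_on_eq_continuous_within)
qed

text \<open>At \<epsilon> = 0 \<open>reg_entropy\<close> is the entropy up to an additive constant;
  subtracting the value at \<gamma>, where S vanishes, removes that constant.\<close>

lemma S_eq_reg_entropy:
  assumes "0 < \<gamma>" "\<gamma> < 1" "m \<in> {0..1}"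
  shows "S \<gamma> m = reg_entropy \<gamma> 0 m - reg_entropy \<gamma> 0 \<gamma>"
proof -
  have "m * ln (m / \<gamma>) = m * ln m - m * ln \<gamma>"
    using assms by (cases "m = 0") (auto simp: ln_div algebra_simps)
  moreover have "(1 - m) * ln ((1 - m) / (1 - \<gamma>)) = (1 - m) * ln (1 - m) - (1 - m) * ln (1 - \<gamma>)"
    using assms by (cases "m = 1") (auto simp: ln_div right_diff_distrib)
  ultimately show ?thesis
    using assms by (simp add: S_def reg_entropy_def ln_div algebra_simps)
qed

lemma reg_entropy_has_real_derivative:
  assumes "0 < x + \<epsilon>" "0 < 1 - x + \<epsilon>"
  shows "(reg_entropy \<gamma> \<epsilon> has_real_derivative reg_force \<gamma> \<epsilon> x) (at x within A)"
  unfolding reg_entropy_def reg_force_def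
  by (rule derivative_eq_intros refl | use assms in \<open>simp add: field_simps\<close>)+

text \<open>The derivative blows up at 0 and 1; continuity there lets the fundamental theorem cover
  a path that ends on the boundary.\<close>

lemma continuous_on_reg_entropy_0: "continuous_on {0..1} (reg_entropy \<gamma> 0)"
proof -
  have "continuous_on {0..1} (\<lambda>x::real. x * ln x)"
    by (rule continuous_on_subset[OF continuous_on_x_ln_x]) auto
  moreover have "continuous_on {0..1} (\<lambda>x::real. (1 - x) * ln (1 - x))"
    by (rule continuous_on_compose2[OF continuous_on_x_ln_x]) (auto intro!: continuous_intros)
  ultimately show ?thesis
    unfolding reg_entropy_def by (auto intro!: continuous_intros)
qed

text \<open>Pointwise convergence suffices, as only the two endpoint values of a path enter the
  lower bound.\<close>

lemma reg_entropy_tendsto: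
  assumes "x \<in> {0..1}"
  shows "((\<lambda>\<epsilon>. reg_entropy \<gamma> \<epsilon> x) \<longlongrightarrow> reg_entropy \<gamma> 0 x) (at_right 0)"
proof -
  have shift: "((\<lambda>\<epsilon>. (y + \<epsilon>) * ln (y + \<epsilon>)) \<longlongrightarrow> y * ln y) (at_right 0)" if "0 \<le> y" for y :: real
  proof -
    have "continuous_on {0..} (\<lambda>\<epsilon>. (y + \<epsilon>) * ln (y + \<epsilon>))"
      by (rule continuous_on_compose2[OF continuous_on_x_ln_x])
        (use that in \<open>auto intro!: continuous_intros\<close>)
    then have "((\<lambda>\<epsilon>. (y + \<epsilon>) * ln (y + \<epsilon>)) \<longlongrightarrow> (y + 0) * ln (y + 0)) (at 0 within {0..})"
      unfolding continuous_on_def by blast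
    then show ?thesis
      by (simp add: at_within_Ici_at_right)
  qed
  show ?thesis
    using shift[of x] shift[of "1 - x"] assms
    unfolding reg_entropy_def by (auto intro!: tendsto_intros)
qed

section \<open>The action as an integral along the path, and the lower bound\<close>

lemma J_has_integral:
  assumes "0 < T" "G \<in> C1 T" "continuous_on {0..T} a'"
    and a: "\<And>s. s \<in> {0..T} \<Longrightarrow> (a has_real_derivative a' s) (at s within {0..T})"
  shows "((\<lambda>s. a' s * G s - drift \<gamma> G a s) has_integral J \<gamma> T G a) {0..T}"
proof -
  obtain G' where G'c: "continuous_on {0..T} G'"
    and G: "\<And>s. s \<in> {0..T} \<Longrightarrow> (G has_real_derivative G' s) (at s within {0..T})"
    using assms(2) unfolding C1_def by blast
  have ac: "continuous_on {0..T} a" and Gc: "continuous_on {0..T} G"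
    by (rule DERIV_continuous_on, erule a) (rule DERIV_continuous_on, erule G)
  have aG': "((\<lambda>s. a s * G' s) has_integral integral {0..T} (\<lambda>s. a s * G' s)) {0..T}"
    by (intro integrable_integral integrable_continuous_real continuous_intros ac G'c)
  \<comment> \<open>Integration by parts moves the derivative from \<open>G\<close> to
    \<open>a\<close>. The integrand then depends on the values of \<open>G\<close> only, so bounds
    on \<open>J\<close> reduce to pointwise ones.\<close>
  have "((\<lambda>s. a' s * G s + a s * G' s) has_integral a T * G T - a 0 * G 0) {0..T}"
    by (rule fundamental_theorem_of_calculus)
      (use assms(1) in \<open>auto simp flip: has_real_derivative_iff_has_vector_derivative
        intro!: derivative_eq_intros a G\<close>)
  from has_integral_diff[OF this aG'] have a'G: "((\<lambda>s. a' s * G s) has_integral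
      a T * G T - a 0 * G 0 - integral {0..T} (\<lambda>s. a s * G' s)) {0..T}"
    by simp
  have "integral {0..T} (\<lambda>s. a s * vector_derivative G (at s within {0..T})) =
      integral {0..T} (\<lambda>s. a s * G' s)"
    using vector_derivative_C1[OF assms(1) _ G]
    by (intro Henstock_Kurzweil_Integration.integral_cong) simp
  moreover have "(drift \<gamma> G a has_integral integral {0..T} (drift \<gamma> G a)) {0..T}"
    unfolding drift_def
    by (intro integrable_integral integrable_continuous_real continuous_intros ac Gc)
  ultimately show ?thesis
    unfolding J_def by (simp only: has_integral_diff[OF a'G])
qed

text \<open>For \<epsilon> = 0 and x in (0,1) the two jump terms cancel. With the shift, the ratios
  (1-x)/(1-x+\<epsilon>) and x/(x+\<epsilon>) are at most 1, which leaves errors of at most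
  2(1-\<gamma>)\<epsilon> and 2\<gamma>\<epsilon>.\<close>

lemma drift_reg_force_le:
  assumes "0 < \<gamma>" "\<gamma> < 1" "0 < \<epsilon>" "a s \<in> {0..1}"
  shows "drift \<gamma> (\<lambda>s. reg_force \<gamma> \<epsilon> (a s)) a s \<le> 2 * \<epsilon>"
proof -
  define x where "x = a s"
  have x: "0 \<le> x" "x \<le> 1" using assms by (auto simp: x_def)
  have p: "0 < x + \<epsilon>" "0 < 1 - x + \<epsilon>" using x assms by auto
  have e1: "exp (reg_force \<gamma> \<epsilon> x) = (x + \<epsilon>) / (1 - x + \<epsilon>) * ((1 - \<gamma>) / \<gamma>)"
    using p assms by (simp add: reg_force_def exp_add exp_diff)
  have e2: "exp (- reg_force \<gamma> \<epsilon> x) = (1 - x + \<epsilon>) / (x + \<epsilon>) * (\<gamma> / (1 - \<gamma>))"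
    unfolding exp_minus e1 by (simp add: field_simps)
  have "(1 - x) / (1 - x + \<epsilon>) * (x + \<epsilon>) \<le> 1 * (x + \<epsilon>)"
    using p x assms by (intro mult_right_mono) (auto simp: divide_simps)
  then have 1: "(1 - \<gamma>) * ((1 - x) / (1 - x + \<epsilon>) * (x + \<epsilon>) - x) \<le> (1 - \<gamma>) * \<epsilon>"
    using assms by (intro mult_left_mono) auto
  have "x / (x + \<epsilon>) * (1 - x + \<epsilon>) \<le> 1 * (1 - x + \<epsilon>)"
    using p x assms by (intro mult_right_mono) (auto simp: divide_simps)
  then have 2: "\<gamma> * (x / (x + \<epsilon>) * (1 - x + \<epsilon>) - (1 - x)) \<le> \<gamma> * \<epsilon>"
    using assms by (intro mult_left_mono) auto
  have g: "\<gamma> * (y * ((1 - \<gamma>) / \<gamma>) - 1) = (1 - \<gamma>) * y - \<gamma>"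
    "(1 - \<gamma>) * (y * (\<gamma> / (1 - \<gamma>)) - 1) = \<gamma> * y - (1 - \<gamma>)" for y
    using assms by (auto simp: field_simps)
  have r: "2 * \<gamma> * (1 - x) * (y - 1) + 2 * (1 - \<gamma>) * x * (z - 1) =
      2 * (1 - x) * (\<gamma> * (y - 1)) + 2 * x * ((1 - \<gamma>) * (z - 1))" for y z
    by (simp add: algebra_simps)
  have "drift \<gamma> (\<lambda>s. reg_force \<gamma> \<epsilon> (a s)) a s =
      2 * (1 - x) * (\<gamma> * ((x + \<epsilon>) / (1 - x + \<epsilon>) * ((1 - \<gamma>) / \<gamma>) - 1)) +
      2 * x * ((1 - \<gamma>) * ((1 - x + \<epsilon>) / (x + \<epsilon>) * (\<gamma> / (1 - \<gamma>)) - 1))"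
    unfolding drift_def x_def[symmetric] e1 e2 by (rule r)
  also have "\<dots> = 2 * ((1 - \<gamma>) * ((1 - x) / (1 - x + \<epsilon>) * (x + \<epsilon>) - x)) +
      2 * (\<gamma> * (x / (x + \<epsilon>) * (1 - x + \<epsilon>) - (1 - x)))"
    unfolding g by (simp add: algebra_simps)
  also have "\<dots> \<le> 2 * ((1 - \<gamma>) * \<epsilon>) + 2 * (\<gamma> * \<epsilon>)"
    using 1 2 by linarith
  finally show ?thesis by (simp add: algebra_simps)
qed

text \<open>Test with \<open>reg_force\<close> along the path: the velocity term integrates to the
  entropy difference, and the Hamiltonian costs at most 2\<epsilon> per unit of time.\<close>

lemma reg_entropy_diff_le_rate:
  assumes "0 < \<gamma>" "\<gamma> < 1" "0 < T" "0 < \<epsilon>" "a \<in> C1 T" "a ` {0..T} \<subseteq> {0..1}"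
  shows "ereal (reg_entropy \<gamma> \<epsilon> (a T) - reg_entropy \<gamma> \<epsilon> (a 0) - 2 * \<epsilon> * T) \<le> rate \<gamma> T a"
proof -
  obtain a' where a'c: "continuous_on {0..T} a'"
    and a: "\<And>s. s \<in> {0..T} \<Longrightarrow> (a has_real_derivative a' s) (at s within {0..T})"
    using assms(5) unfolding C1_def by blast
  have ac: "continuous_on {0..T} a"
    using a by (rule DERIV_continuous_on)
  have a01: "0 \<le> a s" "a s \<le> 1" if "s \<in> {0..T}" for s
    using assms(6) that by (auto simp: image_subset_iff)
  have pos: "0 < a s + \<epsilon>" "0 < 1 - a s + \<epsilon>" if "s \<in> {0..T}" for s
    using a01[OF that] assms(4) by linarith+
  define G where "G = (\<lambda>s. reg_force \<gamma> \<epsilon> (a s))"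
  define G' where "G' = (\<lambda>s. a' s / (a s + \<epsilon>) + a' s / (1 - a s + \<epsilon>))"
  have "(G has_real_derivative G' s) (at s within {0..T})" if "s \<in> {0..T}" for s
    unfolding G_def G'_def reg_force_def
    by (rule derivative_eq_intros refl a that | use pos[OF that] in \<open>simp add: field_simps\<close>)+
  moreover have "continuous_on {0..T} G'"
    unfolding G'_def using pos by (intro continuous_intros ac a'c) (auto simp: less_imp_neq[THEN not_sym])
  ultimately have G: "G \<in> C1 T"
    unfolding C1_def by blast
  have "((\<lambda>s. reg_force \<gamma> \<epsilon> (a s) * a' s) has_integral
      reg_entropy \<gamma> \<epsilon> (a T) - reg_entropy \<gamma> \<epsilon> (a 0)) {0..T}"
    by (rule fundamental_theorem_of_calculus)
      (use assms(3) pos in \<open>auto simp flip: has_real_derivative_iff_has_vector_derivative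
        intro!: DERIV_chain2[OF reg_entropy_has_real_derivative] a\<close>)
  moreover have "((\<lambda>s. 2 * \<epsilon>) has_integral 2 * \<epsilon> * T) {0..T}"
    using has_integral_const_real[of "2 * \<epsilon>" 0 T] assms(3) by (simp add: mult_ac)
  ultimately have "((\<lambda>s. reg_force \<gamma> \<epsilon> (a s) * a' s - 2 * \<epsilon>) has_integral
      reg_entropy \<gamma> \<epsilon> (a T) - reg_entropy \<gamma> \<epsilon> (a 0) - 2 * \<epsilon> * T) {0..T}"
    by (rule has_integral_diff)
  then have "reg_entropy \<gamma> \<epsilon> (a T) - reg_entropy \<gamma> \<epsilon> (a 0) - 2 * \<epsilon> * T \<le> J \<gamma> T G a"
  proof (rule has_integral_le[OF _ J_has_integral[OF assms(3) G a'c a]])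
    fix s assume "s \<in> {0..T}"
    then show "reg_force \<gamma> \<epsilon> (a s) * a' s - 2 * \<epsilon> \<le> a' s * G s - drift \<gamma> G a s"
      using drift_reg_force_le[OF assms(1,2,4), of a s] a01[of s] by (simp add: G_def mult.commute)
  qed
  also have "ereal (J \<gamma> T G a) \<le> rate \<gamma> T a"
    unfolding rate_def by (rule SUP_upper[OF G])
  finally show ?thesis by simp
qed

text \<open>Let \<epsilon> tend to 0 with \<open>T\<close> and the path fixed, so that the error
  2\<epsilon>T vanishes.\<close>

lemma S_le_rate:
  assumes "0 < \<gamma>" "\<gamma> < 1" "0 < T" "a \<in> C1 T" "a ` {0..T} \<subseteq> {0..1}" "a 0 = \<gamma>"
  shows "ereal (S \<gamma> (a T)) \<le> rate \<gamma> T a"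
proof (rule tendsto_upperbound)
  have aT: "a T \<in> {0..1}" using assms(3,5) by (auto simp: image_subset_iff)
  have "((\<lambda>\<epsilon>. reg_entropy \<gamma> \<epsilon> (a T) - reg_entropy \<gamma> \<epsilon> (a 0) - 2 * \<epsilon> * T)
      \<longlongrightarrow> reg_entropy \<gamma> 0 (a T) - reg_entropy \<gamma> 0 (a 0) - 2 * 0 * T) (at_right 0)"
    using assms aT by (intro tendsto_intros reg_entropy_tendsto) auto
  then show "((\<lambda>\<epsilon>. ereal (reg_entropy \<gamma> \<epsilon> (a T) - reg_entropy \<gamma> \<epsilon> (a 0) - 2 * \<epsilon> * T))
      \<longlongrightarrow> ereal (S \<gamma> (a T))) (at_right 0)"
    using assms by (simp add: S_eq_reg_entropy[OF assms(1,2) aT])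
  show "\<forall>\<^sub>F \<epsilon> in at_right 0.
      ereal (reg_entropy \<gamma> \<epsilon> (a T) - reg_entropy \<gamma> \<epsilon> (a 0) - 2 * \<epsilon> * T) \<le> rate \<gamma> T a"
    unfolding eventually_at_right_field
    using reg_entropy_diff_le_rate[OF assms(1-3) _ assms(4,5)] by (intro exI[of _ 1]) auto
qed simp

section \<open>Pointwise upper bound for the Lagrangian\<close>

lemma exp_minus_one_minus_ge_0: "0 \<le> exp x - 1 - (x::real)"
  using exp_ge_add_one_self[of x] by linarith

text \<open>For q \<ge> 0 combine Young's inequality wq \<le> cq^2/2 + w^2/(2c) with exp q - 1 - q
  \<ge> q^2/2; for q < 0 the left side is not positive. Hence \<open>d\<close> may be arbitrarily
  small.\<close>

lemma linear_le_exp_excess: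
  fixes w q b c d :: real
  assumes "0 < c" "0 \<le> b" "0 \<le> d" "0 \<le> w" "c \<le> b"
  shows "w * q \<le> b * (exp q - 1 - q) + d * (exp (- q) - 1 + q) + w\<^sup>2 / (2 * c)"
proof (cases "0 \<le> q")
  case True
  have "0 \<le> (w - c * q)\<^sup>2 / (2 * c)"
    using assms by simp
  then have "w * q \<le> c * (q\<^sup>2 / 2) + w\<^sup>2 / (2 * c)"
    using assms by (simp add: power2_eq_square field_simps)
  also have "c * (q\<^sup>2 / 2) \<le> b * (exp q - 1 - q)"
    using exp_lower_Taylor_quadratic[OF True] assms by (intro mult_mono) auto
  also have "b * (exp q - 1 - q) \<le> b * (exp q - 1 - q) + d * (exp (- q) - 1 + q)"
    using exp_minus_one_minus_ge_0[of "- q"] assms by simp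
  finally show ?thesis by simp
next
  case False
  then have "w * q \<le> 0"
    using assms by (simp add: mult_nonneg_nonpos)
  moreover have "0 \<le> b * (exp q - 1 - q)" "0 \<le> d * (exp (- q) - 1 + q)" "0 \<le> w\<^sup>2 / (2 * c)"
    using exp_minus_one_minus_ge_0[of "- q"] exp_minus_one_minus_ge_0[of q] assms by simp_all
  ultimately show ?thesis by linarith
qed

text \<open>
  The substitution \<open>G = S'(a) + q\<close> turns the two jump rates into those of the reversed dynamics.
  Only the rate in the direction of \<open>w\<close> has to be bounded below, so the estimate is uniform up to
  the boundary of \<open>[0,1]\<close>.
\<close>

lemma lagrangian_le:
  assumes "0 < \<gamma>" "\<gamma> < 1" "0 < a s" "a s < 1" "v = 2 * (a s - \<gamma>) + w"
    and w: "0 \<le> w \<and> \<gamma> \<le> a s \<or> w \<le> 0 \<and> a s \<le> \<gamma>"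
  shows "v * G s - drift \<gamma> G a s \<le> reg_force \<gamma> 0 (a s) * v + w\<^sup>2 / (4 * \<gamma> * (1 - \<gamma>))"
proof -
  define x where "x = a s"
  have x: "0 < x" "x < 1" using assms by (auto simp: x_def)
  define q where "q = G s - reg_force \<gamma> 0 x"
  define b where "b = 2 * (1 - \<gamma>) * x"
  define d where "d = 2 * \<gamma> * (1 - x)"
  \<comment> \<open>The common value of \<open>b\<close> and \<open>d\<close> at x = \<gamma>;
    \<open>b\<close> increases and \<open>d\<close> decreases in x, so on either side of \<gamma>
    one of them is at least \<open>c\<close>.\<close>
  define c where "c = 2 * \<gamma> * (1 - \<gamma>)"
  have nn: "0 < c" "0 \<le> b" "0 \<le> d" using assms x by (auto simp: b_def c_def d_def)
  have cb: "c \<le> b" if "\<gamma> \<le> x"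
    using mult_left_mono[OF that, of "2 * (1 - \<gamma>)"] assms by (simp add: b_def c_def mult_ac)
  have cd: "c \<le> d" if "x \<le> \<gamma>"
    using mult_left_mono[of "1 - \<gamma>" "1 - x" "2 * \<gamma>"] that assms by (simp add: c_def d_def)
  have ef: "exp (reg_force \<gamma> 0 x) = x / (1 - x) * ((1 - \<gamma>) / \<gamma>)"
    using x assms by (simp add: reg_force_def exp_add exp_diff)
  have e1: "exp (G s) = x / (1 - x) * ((1 - \<gamma>) / \<gamma>) * exp q"
    unfolding ef[symmetric] q_def by (simp flip: exp_add)
  have e2: "exp (- G s) = (1 - x) / x * (\<gamma> / (1 - \<gamma>)) * exp (- q)"
    unfolding exp_minus e1 by (simp add: field_simps)
  \<comment> \<open>The tilt by S' exchanges the upward rate \<open>d\<close> and the downward rate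
    \<open>b\<close>.\<close>
  have "d * exp (G s) = b * exp q" "b * exp (- G s) = d * exp (- q)"
    unfolding e1 e2 b_def d_def using x assms by (auto simp: field_simps)
  moreover have "drift \<gamma> G a s = (d * exp (G s) - d) + (b * exp (- G s) - b)"
    by (simp add: drift_def x_def b_def d_def algebra_simps)
  ultimately have dr: "drift \<gamma> G a s = b * exp q - d + (d * exp (- q) - b)"
    by simp
  have "b - d = 2 * (x - \<gamma>)"
    by (simp add: b_def d_def algebra_simps)
  then have v: "v = b - d + w" using assms by (simp add: x_def)
  have "w * q \<le> b * (exp q - 1 - q) + d * (exp (- q) - 1 + q) + w\<^sup>2 / (2 * c)"
    using w
  proof
    assume "0 \<le> w \<and> \<gamma> \<le> a s"
    then show ?thesis
      by (intro linear_le_exp_excess nn cb) (auto simp: x_def)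
  next
    assume "w \<le> 0 \<and> a s \<le> \<gamma>"
    \<comment> \<open>Mirror image of the first case: the signs of \<open>w\<close> and
      \<open>q\<close> flip, and \<open>b\<close> and \<open>d\<close> change places.\<close>
    then have "(- w) * (- q) \<le>
        d * (exp (- q) - 1 - (- q)) + b * (exp (- (- q)) - 1 + (- q)) + (- w)\<^sup>2 / (2 * c)"
      by (intro linear_le_exp_excess nn cd) (auto simp: x_def)
    then show ?thesis by simp
  qed
  then have "v * q - drift \<gamma> G a s \<le> w\<^sup>2 / (2 * c)"
    unfolding dr v by (simp add: algebra_simps)
  then show ?thesis
    by (simp add: q_def c_def x_def algebra_simps)
qed

section \<open>The explicit path and its cost\<close>

lemma le_sinh: "x \<le> sinh x" if "0 \<le> x" for x :: real
proof -
  have "(\<lambda>x. sinh x - x) 0 \<le> (\<lambda>x. sinh x - x) x"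
    by (rule DERIV_nonneg_imp_nondecreasing[OF that])
      (auto intro!: derivative_eq_intros exI simp: cosh_real_ge_1)
  then show ?thesis by simp
qed

text \<open>The reversed drift alone never leaves \<gamma>, hence the push \<open>w\<close>. With
  sinh it satisfies |w| \<le> 1/T, so its cost over time \<open>T\<close> is at most T * (1/T)^2 /
  (4\<gamma>(1-\<gamma>)).\<close>

lemma V_le:
  assumes "0 < \<gamma>" "\<gamma> < 1" "m \<in> {0..1}" "0 < T"
  shows "V \<gamma> m \<le> ereal (S \<gamma> m + 1 / (4 * \<gamma> * (1 - \<gamma>) * T))"
proof -
  define \<theta> where "\<theta> = (\<lambda>t. sinh (2 * t) / sinh (2 * T))"
  define a where "a = (\<lambda>t. \<gamma> + (m - \<gamma>) * \<theta> t)"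
  define a' where "a' = (\<lambda>t. 2 * (m - \<gamma>) * cosh (2 * t) / sinh (2 * T))"
  define w where "w = (\<lambda>t. 2 * (m - \<gamma>) * exp (- 2 * t) / sinh (2 * T))"
  have sT: "0 < sinh (2 * T)" using assms by simp
  have \<theta>: "0 \<le> \<theta> t" "\<theta> t \<le> 1" if "t \<in> {0..T}" for t
    using that sT by (auto simp: \<theta>_def)
  have \<theta>_lt: "\<theta> t < 1" if "t < T" for t
    using that sT by (auto simp: \<theta>_def)
  have a_conv: "a t = (1 - \<theta> t) * \<gamma> + \<theta> t * m" for t
    by (simp add: a_def algebra_simps)
  have a01: "a t \<in> {0..1}" if "t \<in> {0..T}" for t
  proof -
    have "(1 - \<theta> t) * \<gamma> + \<theta> t * m \<in> {0..1}"
      using convexD[OF convex_real_interval(5)[of 0 1], of \<gamma> m "1 - \<theta> t" "\<theta> t"] \<theta>[OF that] assms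
      by simp
    then show ?thesis by (simp only: a_conv)
  qed
  \<comment> \<open>Before time \<open>T\<close> the convex combination gives positive weight to
    \<gamma>, which is interior; only the endpoint \<open>m\<close> can be 0 or 1.\<close>
  have a01_strict: "0 < a t" "a t < 1" if "t \<in> {0<..<T}" for t
  proof -
    have t: "0 < 1 - \<theta> t" "0 \<le> \<theta> t" using \<theta>_lt[of t] \<theta>[of t] that by auto
    show "0 < a t"
      unfolding a_conv using t assms by (intro add_pos_nonneg) auto
    have "1 - a t = (1 - \<theta> t) * (1 - \<gamma>) + \<theta> t * (1 - m)"
      by (simp add: a_conv algebra_simps)
    also have "\<dots> > 0"
      using t assms by (intro add_pos_nonneg) auto
    finally show "a t < 1" by simp
  qed
  have ends: "a 0 = \<gamma>" "a T = m" using sT by (simp_all add: a_def \<theta>_def)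
  have da: "(a has_real_derivative a' t) (at t within A)" for t A
    unfolding a_def a'_def \<theta>_def using sT
    by (auto intro!: derivative_eq_intros)
  have a'c: "continuous_on {0..T} a'"
    unfolding a'_def using sT by (intro continuous_intros) auto
  have aC1: "a \<in> C1 T"
    unfolding C1_def using da a'c by blast
  have ac: "continuous_on {0..T} a"
    by (rule DERIV_continuous_on) (rule da)
  have a'_eq: "a' t = 2 * (a t - \<gamma>) + w t" for t
  proof -
    have "cosh (2 * t) = sinh (2 * t) + exp (- 2 * t)"
      using cosh_minus_sinh[of "2 * t"] by simp
    then show ?thesis
      by (simp add: a'_def a_def w_def \<theta>_def distrib_left add_divide_distrib)
  qed
  have w_sign: "0 \<le> w t \<and> \<gamma> \<le> a t \<or> w t \<le> 0 \<and> a t \<le> \<gamma>" if "t \<in> {0..T}" for t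
    using sT \<theta>[OF that] unfolding w_def a_def
    by (cases "\<gamma> \<le> m") (auto simp: divide_simps mult_nonpos_nonneg)
  have w_le: "(w t)\<^sup>2 \<le> (1 / T)\<^sup>2" if "t \<in> {0..T}" for t
  proof -
    \<comment> \<open>Uses |m - \<gamma>| \<le> 1, exp (-2t) \<le> 1 and sinh (2T) \<ge> 2T.\<close>
    have "\<bar>w t\<bar> = 2 * (\<bar>m - \<gamma>\<bar> * exp (- 2 * t)) / sinh (2 * T)"
      using sT by (simp only: w_def abs_mult abs_divide abs_exp_cancel)
    also have "\<dots> \<le> 2 * (1 * 1) / (2 * T)"
      using that assms le_sinh[of "2 * T"]
      by (intro frac_le mult_mono) auto
    finally have "\<bar>w t\<bar> \<le> \<bar>1 / T\<bar>" using assms by simp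
    then show ?thesis by (simp only: abs_le_square_iff)
  qed
  define K where "K = (1 / T)\<^sup>2 / (4 * \<gamma> * (1 - \<gamma>))"
  have "((\<lambda>s. reg_force \<gamma> 0 (a s) * a' s) has_integral
      reg_entropy \<gamma> 0 (a T) - reg_entropy \<gamma> 0 (a 0)) {0..T}"
  \<comment> \<open>The interior version is needed: for m = 0 or m = 1 the entropy is not
    differentiable at the end of the path.\<close>
  proof (rule fundamental_theorem_of_calculus_interior)
    show "continuous_on {0..T} (\<lambda>s. reg_entropy \<gamma> 0 (a s))"
      by (rule continuous_on_compose2[OF continuous_on_reg_entropy_0 ac]) (use a01 in auto)
    show "((\<lambda>s. reg_entropy \<gamma> 0 (a s)) has_vector_derivative reg_force \<gamma> 0 (a s) * a' s) (at s)"
      if "s \<in> {0<..<T}" for s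
      using a01_strict[OF that]
      by (auto simp flip: has_real_derivative_iff_has_vector_derivative
          intro!: DERIV_chain2[OF reg_entropy_has_real_derivative] da)
  qed (use assms in simp)
  moreover have "((\<lambda>s. K) has_integral K * T) {0..T}"
    using has_integral_const_real[of K 0 T] assms by (simp add: mult_ac)
  ultimately have "((\<lambda>s. reg_force \<gamma> 0 (a s) * a' s + K) has_integral
      reg_entropy \<gamma> 0 (a T) - reg_entropy \<gamma> 0 (a 0) + K * T) {0..T}"
    by (rule has_integral_add)
  moreover have "reg_entropy \<gamma> 0 (a T) - reg_entropy \<gamma> 0 (a 0) = S \<gamma> m"
    using S_eq_reg_entropy[OF assms(1-3)] by (simp add: ends)
  moreover have "K * T = 1 / (4 * \<gamma> * (1 - \<gamma>) * T)"
    using assms by (simp add: K_def power2_eq_square)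
  \<comment> \<open>Dropping the endpoints leaves only times with 0 < a < 1, where
    \<open>lagrangian_le\<close> applies.\<close>
  ultimately have upper: "((\<lambda>s. reg_force \<gamma> 0 (a s) * a' s + K) has_integral
      S \<gamma> m + 1 / (4 * \<gamma> * (1 - \<gamma>) * T)) {0<..<T}"
    by (simp add: has_integral_Icc_iff_Ioo)
  have "J \<gamma> T G a \<le> S \<gamma> m + 1 / (4 * \<gamma> * (1 - \<gamma>) * T)" if G: "G \<in> C1 T" for G
  proof (rule has_integral_le[OF _ upper])
    show "((\<lambda>s. a' s * G s - drift \<gamma> G a s) has_integral J \<gamma> T G a) {0<..<T}"
      using J_has_integral[OF assms(4) G a'c da] by (simp add: has_integral_Icc_iff_Ioo)
    fix s assume s: "s \<in> {0<..<T}"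
    have "a' s * G s - drift \<gamma> G a s \<le> reg_force \<gamma> 0 (a s) * a' s + (w s)\<^sup>2 / (4 * \<gamma> * (1 - \<gamma>))"
      using s by (intro lagrangian_le assms a01_strict a'_eq w_sign) auto
    also have "(w s)\<^sup>2 / (4 * \<gamma> * (1 - \<gamma>)) \<le> K"
      unfolding K_def using w_le[of s] s assms by (intro divide_right_mono) auto
    finally show "a' s * G s - drift \<gamma> G a s \<le> reg_force \<gamma> 0 (a s) * a' s + K"
      by simp
  qed
  then have "rate_from \<gamma> T a \<gamma> \<le> ereal (S \<gamma> m + 1 / (4 * \<gamma> * (1 - \<gamma>) * T))"
    by (simp add: rate_from_def ends rate_def SUP_le_iff)
  moreover have "a \<in> C1_paths_to T m"
    unfolding C1_paths_to_def using aC1 a01 ends by blast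
  ultimately show ?thesis
    unfolding V_def using assms(4) by (meson INF_lower2 greaterThan_iff)
qed

section \<open>Long times and the identity of \<open>V\<close> and \<open>S\<close>\<close>

theorem lemma2p7:
  fixes \<alpha> \<beta> \<gamma> m :: real
  assumes "0 < \<alpha>" "\<alpha> < 1" "0 < \<beta>" "\<beta> < 1"
    and "\<gamma> = (\<alpha> + \<beta>) / 2"
    and "m \<in> {0..1}"
  shows "V \<gamma> m = ereal (S \<gamma> m)"
proof (rule antisym)
  have \<gamma>: "0 < \<gamma>" "\<gamma> < 1" using assms by auto
  show "V \<gamma> m \<le> ereal (S \<gamma> m)"
  \<comment> \<open>\<open>V\<close> does not depend on \<open>T\<close>, so the bound may be taken
    to the limit of infinite \<open>T\<close>.\<close>
  proof (rule tendsto_lowerbound)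
    have "((\<lambda>T. 1 / (4 * \<gamma> * (1 - \<gamma>) * T)) \<longlongrightarrow> 0) at_top"
      using \<gamma> by real_asymp
    then have "((\<lambda>T. S \<gamma> m + 1 / (4 * \<gamma> * (1 - \<gamma>) * T)) \<longlongrightarrow> S \<gamma> m + 0) at_top"
      by (intro tendsto_intros)
    then show "((\<lambda>T. ereal (S \<gamma> m + 1 / (4 * \<gamma> * (1 - \<gamma>) * T))) \<longlongrightarrow> ereal (S \<gamma> m)) at_top"
      by simp
    show "\<forall>\<^sub>F T in at_top. V \<gamma> m \<le> ereal (S \<gamma> m + 1 / (4 * \<gamma> * (1 - \<gamma>) * T))"
      using eventually_gt_at_top[of 0] by eventually_elim (rule V_le[OF \<gamma> assms(6)])
  qed simp
  show "ereal (S \<gamma> m) \<le> V \<gamma> m"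
    unfolding V_def
  proof (intro INF_greatest)
    fix T a assume "T \<in> {0::real<..}" "a \<in> C1_paths_to T m"
    \<comment> \<open>A path that does not start at \<gamma> has infinite cost; the others fall
      under \<open>S_le_rate\<close>.\<close>
    then show "ereal (S \<gamma> m) \<le> rate_from \<gamma> T a \<gamma>"
      using S_le_rate[OF \<gamma>, of T a] by (auto simp: rate_from_def C1_paths_to_def)
  qed
qed

end
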